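(* For any integers $k\ge 2$ and $t\ge 1$, there exists a colour-balanced $k$-edge-colouring of the complete bipartite graph $K_{kt,kt}$ with no colour-balanced perfect matching.
   Context: A $k$-edge-colouring is an arbitrary (not necessarily proper) map from the edge set to $[k]=\{1,\dots,k\}$; it is colour-balanced if all $k$ colour classes have the same size. A perfect matching is colour-balanced if each of the $k$ colours appears on equally many of its edges (here exactly $t$ each). $K_{kt,kt}$ is the complete bipartite graph with both parts of size $kt$. *)

theory Defs
  imports Main "HOL-Library.FuncSet"
begin

(* Undirected simple graphs are given by a vertex set and a set of edges, an edge being the
   two-element set of its ends. *)

definition complete_bipartite_edges :: "'v set \<Rightarrow> 'v set \<Rightarrow> 'v set set" where
  "complete_bipartite_edges A B = {{a, b} | a b. a \<in> A \<and> b \<in> B}"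

definition perfect_matching :: "'v set \<Rightarrow> 'v set set \<Rightarrow> 'v set set \<Rightarrow> bool" where
  "perfect_matching V E M \<longleftrightarrow> M \<subseteq> E \<and> (\<forall>v\<in>V. \<exists>!e. e \<in> M \<and> v \<in> e)"

(* Not necessarily proper. *)
definition edge_colouring :: "nat \<Rightarrow> 'v set set \<Rightarrow> ('v set \<Rightarrow> nat) \<Rightarrow> bool" where
  "edge_colouring k E c \<longleftrightarrow> c \<in> E \<rightarrow> {1..k}"

(* Used both for the whole edge set (a colour-balanced colouring) and for a perfect matching.
   F is meant to be finite, as card is 0 on infinite sets. *)
definition colour_balanced :: "nat \<Rightarrow> ('v set \<Rightarrow> nat) \<Rightarrow> 'v set set \<Rightarrow> bool" where
  "colour_balanced k c F \<longleftrightarrow>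
     (\<forall>i\<in>{1..k}. \<forall>j\<in>{1..k}. card {e \<in> F. c e = i} = card {e \<in> F. c e = j})"

end

theory Submission
  imports Defs
begin

text \<open>
  Label the vertices by \<open>h\<close>, with values in \<open>\<int>/k\<close>, and colour an edge by the sum of the labels of
  its ends. If the labels are equidistributed on \<open>A\<close>, the colouring is balanced whatever the
  labels on \<open>B\<close> are. The colours of a perfect matching always add up to the sum of all labels,
  whereas those of a balanced perfect matching add up to \<open>t * (0 + ... + (k - 1))\<close>, which
  is already the sum of the labels on \<open>A\<close>. Hence it suffices that the labels on \<open>B\<close> have sum \<open>1\<close>.
\<close>

text \<open>Two distinct members of a window of \<open>k\<close> consecutive naturals differ by less
  than \<open>k\<close>, so their residues differ after any shift \<open>g\<close>; by cardinality
  every residue then occurs exactly once.\<close>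

lemma sum_mod_block:
  fixes F :: "nat \<Rightarrow> 'a::comm_monoid_add"
  assumes "k > 0"
  shows "(\<Sum>x\<in>{m..<m + k}. F ((x + g) mod k)) = (\<Sum>i<k. F i)"
proof -
  have inj: "inj_on (\<lambda>x. (x + g) mod k) {m..<m + k}"
  proof (rule linorder_inj_onI)
    fix x y assume xy: "x < y" "x \<in> {m..<m + k}" "y \<in> {m..<m + k}"
    show "(x + g) mod k \<noteq> (y + g) mod k"
    proof
      assume "(x + g) mod k = (y + g) mod k"
      then have "k dvd y - x"
        using mod_eq_dvd_iff_nat[of "x + g" "y + g" k] xy(1) by simp
      then show False
        using xy dvd_imp_le[of k "y - x"] by auto
    qed
  qed auto
  have "(\<lambda>x. (x + g) mod k) ` {m..<m + k} = {..<k}"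
    using assms card_image[OF inj] by (intro card_subset_eq) auto
  with inj have "bij_betw (\<lambda>x. (x + g) mod k) {m..<m + k} {..<k}"
    by (simp add: bij_betw_def)
  then show ?thesis
    by (rule sum.reindex_bij_betw)
qed

text \<open>Cut the range into \<open>t\<close> windows of length \<open>k\<close>. An indicator as
  \<open>F\<close> will count residues, the identity as \<open>F\<close> will add them up.\<close>

lemma sum_mod_blocks:
  fixes F :: "nat \<Rightarrow> nat"
  assumes "k > 0"
  shows "(\<Sum>x<t * k. F ((x + g) mod k)) = t * (\<Sum>i<k. F i)"
  using sum.nat_group[of "\<lambda>x. F ((x + g) mod k)" k t] sum_mod_block[OF assms, of F g] by simp

lemma card_mod_eq:
  assumes "(i::nat) < k"
  shows "card {x \<in> {..<t * k}. (x + g) mod k = i} = t"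
proof -
  have "card {x \<in> {..<t * k}. (x + g) mod k = i} = (\<Sum>x<t * k. if (x + g) mod k = i then 1 else 0)"
    by (simp flip: sum.inter_filter)
  also have "\<dots> = t"
    using sum_mod_blocks[of k "\<lambda>j. if j = i then 1 else 0" g t] assms by simp
  finally show ?thesis .
qed

text \<open>Double counting: the edges of a perfect matching partition \<open>V\<close>.\<close>

lemma sum_perfect_matching:
  fixes h :: "'v \<Rightarrow> nat"
  assumes "perfect_matching V E M" "\<And>e. e \<in> E \<Longrightarrow> e \<subseteq> V" "finite V"
  shows "(\<Sum>e\<in>M. \<Sum>v\<in>e. h v) = (\<Sum>v\<in>V. h v)"
proof -
  have ME: "M \<subseteq> E" and ex1: "\<And>v. v \<in> V \<Longrightarrow> \<exists>!e. e \<in> M \<and> v \<in> e"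
    using assms(1) by (auto simp: perfect_matching_def)
  have sub: "\<forall>e\<in>M. e \<subseteq> V"
    using ME assms(2) by blast
  have "\<Union> M = V"
    using sub ex1 by blast
  moreover have "\<forall>e\<in>M. finite e"
    using sub assms(3) finite_subset by blast
  moreover have "\<forall>d\<in>M. \<forall>e\<in>M. d \<noteq> e \<longrightarrow> d \<inter> e = {}"
    using sub ex1 by blast
  ultimately show ?thesis
    using sum.Union_disjoint[of M h] by simp
qed

text \<open>Since the sides are disjoint, an edge determines which of its ends lies in
  \<open>A\<close>, so unordered edges can be counted as ordered pairs.\<close>

lemma card_edges_eq_card_pairs:
  assumes "A \<inter> B = {}"
  shows "card {e \<in> complete_bipartite_edges A B. P e} = card {(a, b). a \<in> A \<and> b \<in> B \<and> P {a, b}}"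
proof -
  have "{e \<in> complete_bipartite_edges A B. P e}
      = (\<lambda>(a, b). {a, b}) ` {(a, b). a \<in> A \<and> b \<in> B \<and> P {a, b}}"
    by (auto simp: complete_bipartite_edges_def)
  moreover have "inj_on (\<lambda>(a, b). {a, b}) {(a, b). a \<in> A \<and> b \<in> B \<and> P {a, b}}"
    using assms by (auto simp: inj_on_def doubleton_eq_iff)
  ultimately show ?thesis
    by (simp add: card_image)
qed

text \<open>\<open>Suc\<close> moves the residues 0, ..., k - 1 to the colours 1, ..., k.\<close>

definition sum_colouring :: "nat \<Rightarrow> ('v \<Rightarrow> nat) \<Rightarrow> 'v set \<Rightarrow> nat" where
  "sum_colouring k h e = Suc ((\<Sum>v\<in>e. h v) mod k)"

text \<open>Fix \<open>b\<close>: as \<open>a\<close> runs through \<open>A\<close>, the sum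
  \<open>h a + h b\<close> runs through \<open>t * k\<close> consecutive integers and meets each
  residue \<open>t\<close> times. Hence every colour class has \<open>card B * t\<close>
  edges.\<close>

lemma sum_colouring_balanced:
  assumes bij: "bij_betw h A {..<t * k}" and "finite A" "finite B" "A \<inter> B = {}"
  shows "colour_balanced k (sum_colouring k h) (complete_bipartite_edges A B)"
proof -
  have "card {e \<in> complete_bipartite_edges A B. sum_colouring k h e = i} = card B * t"
    if i: "i \<in> {1..k}" for i
  proof -
    have fibre: "card {a \<in> A. sum_colouring k h {a, b} = i} = t" if "b \<in> B" for b
    proof -
      have "sum_colouring k h {a, b} = i \<longleftrightarrow> (h a + h b) mod k = i - 1" if "a \<in> A" for a
      proof -
        \<comment> \<open>Otherwise \<open>{a, b}\<close> would be a singleton and its label sum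
          would be \<open>h a\<close> alone.\<close>
        have "a \<noteq> b"
          using \<open>a \<in> A\<close> \<open>b \<in> B\<close> assms(4) by blast
        then show ?thesis
          using i by (auto simp: sum_colouring_def)
      qed
      then have fibre_eq: "{a \<in> A. sum_colouring k h {a, b} = i} = {a \<in> A. (h a + h b) mod k = i - 1}"
        by blast
      have "bij_betw h {a \<in> A. (h a + h b) mod k = i - 1}
          {x \<in> {..<t * k}. (x + h b) mod k = i - 1}"
        using bij by (auto simp: bij_betw_def inj_on_def)
      then have "card {a \<in> A. (h a + h b) mod k = i - 1}
          = card {x \<in> {..<t * k}. (x + h b) mod k = i - 1}"
        by (rule bij_betw_same_card)
      also have "\<dots> = t"
        by (rule card_mod_eq) (use i in auto)
      finally show ?thesis
        unfolding fibre_eq .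
    qed
    \<comment> \<open>The fibres are counted for fixed \<open>b\<close>, so the pairs are regrouped
      by their second component.\<close>
    have "{(a, b). a \<in> A \<and> b \<in> B \<and> sum_colouring k h {a, b} = i}
        = prod.swap ` (SIGMA b:B. {a \<in> A. sum_colouring k h {a, b} = i})"
      by (auto simp: image_iff)
    then have "card {(a, b). a \<in> A \<and> b \<in> B \<and> sum_colouring k h {a, b} = i}
        = card (SIGMA b:B. {a \<in> A. sum_colouring k h {a, b} = i})"
      by (simp only: card_image inj_swap)
    also have "\<dots> = (\<Sum>b\<in>B. card {a \<in> A. sum_colouring k h {a, b} = i})"
      using assms(2,3) by (intro card_SigmaI) auto
    also have "\<dots> = card B * t"
      using fibre by simp
    finally show ?thesis
      using card_edges_eq_card_pairs[OF assms(4), of "\<lambda>e. sum_colouring k h e = i"] by simp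
  qed
  then show ?thesis
    by (simp add: colour_balanced_def)
qed

lemma colour_balanced_sum:
  fixes F :: "nat \<Rightarrow> nat"
  assumes bal: "colour_balanced k c M" and "finite M" "c \<in> M \<rightarrow> {1..k}" "card M = k * t" "k > 0"
  shows "(\<Sum>e\<in>M. F (c e)) = t * (\<Sum>i\<in>{1..k}. F i)"
proof -
  \<comment> \<open>A general \<open>G\<close> serves twice: the constant 1 shows that the common
    class size is \<open>t\<close>, and \<open>F\<close> then gives the claim.\<close>
  have group: "(\<Sum>e\<in>M. G (c e)) = card {e \<in> M. c e = 1} * (\<Sum>i\<in>{1..k}. G i)" for G :: "nat \<Rightarrow> nat"
  proof -
    have "(\<Sum>e\<in>M. G (c e)) = (\<Sum>i\<in>{1..k}. \<Sum>e\<in>{e \<in> M. c e = i}. G (c e))"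
      using assms(2,3) by (intro sum.group[symmetric]) auto
    also have "\<dots> = (\<Sum>i\<in>{1..k}. card {e \<in> M. c e = i} * G i)"
      by simp
    also have "\<dots> = (\<Sum>i\<in>{1..k}. card {e \<in> M. c e = 1} * G i)"
    proof (rule sum.cong[OF refl])
      fix i assume "i \<in> {1..k}"
      moreover have "1 \<in> {1..k}"
        using assms(5) by simp
      ultimately have "card {e \<in> M. c e = i} = card {e \<in> M. c e = 1}"
        using bal unfolding colour_balanced_def by blast
      then show "card {e \<in> M. c e = i} * G i = card {e \<in> M. c e = 1} * G i"
        by simp
    qed
    finally show ?thesis
      by (simp add: sum_distrib_left)
  qed
  from group[of "\<lambda>_. 1"] have "card {e \<in> M. c e = 1} = t"
    using assms(4,5) by simp
  with group[of F] show ?thesis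
    by simp
qed

text \<open>Modulo \<open>k\<close>, the label sum over \<open>M\<close> is that over
  \<open>A\<close> by balance, and that over \<open>A \<union> B\<close> because \<open>M\<close> is
  perfect; so \<open>B\<close> contributes 0.\<close>

lemma sum_colouring_balanced_matching_dvd:
  assumes "perfect_matching (A \<union> B) (complete_bipartite_edges A B) M"
    and bal: "colour_balanced k (sum_colouring k h) M"
    and bij: "bij_betw h A {..<t * k}"
    and fin: "finite A" "finite B" and disj: "A \<inter> B = {}"
    and card: "card A = k * t" "card B = k * t" and "k > 0"
  shows "k dvd (\<Sum>b\<in>B. h b)"
proof -
  let ?E = "complete_bipartite_edges A B"
  have sub: "e \<subseteq> A \<union> B" if "e \<in> ?E" for e
    using that by (auto simp: complete_bipartite_edges_def)
  note matching_sum = sum_perfect_matching[OF assms(1) sub finite_UnI[OF fin]]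
  have ME: "M \<subseteq> ?E"
    using assms(1) by (simp add: perfect_matching_def)
  have "?E \<subseteq> Pow (A \<union> B)"
    using sub by blast
  then have finM: "finite M"
    using ME fin by (meson finite_Pow_iff finite_UnI finite_subset)
  have "card e = 2" if "e \<in> M" for e
  proof -
    have "e \<in> ?E"
      using that ME by blast
    then obtain a b where "e = {a, b}" "a \<in> A" "b \<in> B"
      unfolding complete_bipartite_edges_def by blast
    moreover from this have "a \<noteq> b"
      using disj by blast
    ultimately show ?thesis
      by simp
  qed
  \<comment> \<open>Weight 1 on every vertex gives 2 |M| = |A| + |B|.\<close>
  then have cardM: "card M = k * t"
    using matching_sum[of "\<lambda>_. 1"] card card_Un_disjoint[OF fin disj] by simp
  have "sum_colouring k h \<in> M \<rightarrow> {1..k}"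
    using \<open>k > 0\<close> by (auto simp: sum_colouring_def Suc_le_eq)
  \<comment> \<open>The choice of \<open>i - 1\<close> undoes the \<open>Suc\<close> in the
    colouring and recovers the residues.\<close>
  from colour_balanced_sum[OF bal finM this cardM \<open>k > 0\<close>, of "\<lambda>i. i - 1"]
  have "(\<Sum>e\<in>M. (\<Sum>v\<in>e. h v) mod k) = t * (\<Sum>i\<in>{1..k}. i - 1)"
    by (simp add: sum_colouring_def)
  also have "(\<Sum>i\<in>{1..k}. i - 1) = (\<Sum>i<k. i)"
    by (rule sum.reindex_bij_witness[of _ Suc "\<lambda>i. i - 1"]) auto
  \<comment> \<open>The total is never evaluated, only recognised as the sum of the residues of the
    labels on \<open>A\<close>.\<close>
  also have "t * (\<Sum>i<k. i) = (\<Sum>x<t * k. x mod k)"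
    using sum_mod_blocks[OF \<open>k > 0\<close>, of "\<lambda>i. i" 0 t] by simp
  also have "\<dots> = (\<Sum>a\<in>A. h a mod k)"
    by (rule sum.reindex_bij_betw[OF bij, symmetric])
  finally have "(\<Sum>e\<in>M. (\<Sum>v\<in>e. h v) mod k) mod k = (\<Sum>a\<in>A. h a mod k) mod k"
    by simp
  then have "(\<Sum>e\<in>M. \<Sum>v\<in>e. h v) mod k = (\<Sum>a\<in>A. h a) mod k"
    by (simp add: mod_sum_eq)
  then have "((\<Sum>a\<in>A. h a) + (\<Sum>b\<in>B. h b)) mod k = (\<Sum>a\<in>A. h a) mod k"
    by (simp add: matching_sum sum.union_disjoint fin disj)
  then show ?thesis
    by (simp add: mod_eq_dvd_iff_nat)
qed

theorem theorem5p2: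
  fixes k t :: nat and A B :: "'v set"
  assumes "k \<ge> 2" and "t \<ge> 1"
    and "finite A" and "finite B" and "A \<inter> B = {}"
    and "card A = k * t" and "card B = k * t"
  shows "\<exists>c. edge_colouring k (complete_bipartite_edges A B) c
           \<and> colour_balanced k c (complete_bipartite_edges A B)
           \<and> \<not> (\<exists>M. perfect_matching (A \<union> B) (complete_bipartite_edges A B) M
                    \<and> colour_balanced k c M)"
proof -
  obtain f where "bij_betw f A {..<t * k}"
    using finite_same_card_bij[OF \<open>finite A\<close>, of "{..<t * k}"] assms(6) by (auto simp: mult.commute)
  moreover obtain b0 where "b0 \<in> B"
    using assms(1,2,7) by fastforce
  \<comment> \<open>A single label 1 on \<open>B\<close>, all others there being 0, makes the sum
    over \<open>B\<close> equal to 1, which \<open>k \<ge> 2\<close> does not divide.\<close>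
  define h where "h v = (if v \<in> A then f v else if v = b0 then 1 else 0)" for v
  ultimately have bij: "bij_betw h A {..<t * k}"
    by (simp add: h_def cong: bij_betw_cong)
  have "(\<Sum>b\<in>B. h b) = (\<Sum>b\<in>B. if b = b0 then 1 else 0)"
    using assms(5) by (intro sum.cong) (auto simp: h_def)
  then have sumB: "(\<Sum>b\<in>B. h b) = 1"
    using \<open>b0 \<in> B\<close> \<open>finite B\<close> by simp
  have "edge_colouring k (complete_bipartite_edges A B) (sum_colouring k h)"
    using assms(1) by (auto simp: edge_colouring_def sum_colouring_def Suc_le_eq)
  moreover have "colour_balanced k (sum_colouring k h) (complete_bipartite_edges A B)"
    using sum_colouring_balanced[OF bij] assms by blast
  moreover have "\<not> colour_balanced k (sum_colouring k h) M"
    if "perfect_matching (A \<union> B) (complete_bipartite_edges A B) M" for M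
  proof
    assume "colour_balanced k (sum_colouring k h) M"
    then have "k dvd (\<Sum>b\<in>B. h b)"
      using sum_colouring_balanced_matching_dvd[OF that _ bij] assms by simp
    then show False
      using sumB assms(1) by simp
  qed
  ultimately show ?thesis
    by blast
qed

end
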